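(* Let $Q$ be a quiver of type $ADE$, let $R$ be its Ringel form, and let $\tilde{w}_0=s_{i_1}s_{i_2}\cdots s_{i_N}$ be a reduced expression of the longest element $w_0$ of the Weyl group which is adapted to $Q$. For $1\le k\le N$ put $\beta_k=s_{i_1}\cdots s_{i_{k-1}}(\alpha_{i_k})$ and $\mu_k=s_{i_1}\cdots s_{i_k}(\omega_{i_k})$. Then the mapping $\varphi_{\tilde{w}_0}:\beta_k\mapsto\mu_k$ is linear (that is, it is the restriction to $\Phi^+$ of a linear map $E\to E$) and is given by the Ringel form: for all $1\le k\le N$, $$\mu_k=-\varphi_R(\beta_k).$$
   Context: Let $D$ be a Dynkin diagram of type $ADE$ with vertex set $I=\{1,\dots,n\}$, $\Phi$ its root system in the real Euclidean space $E$, $\Phi^+$ the positive roots, $N=|\Phi^+|$, $\alpha_i$ the simple roots, $\omega_i\in E$ the fundamental weights, $W$ the Weyl group with simple reflections $s_i$, and $w_0$ its longest element. A quiver $Q$ of type $ADE$ is an orientation of the edges of such a $D$. A vertex $k$ is a sink of $Q$ if all arrows incident to $k$ enter $k$; then $S_kQ$ denotes the quiver obtained by reversing all arrows ending at $k$. A reduced expression $s_{i_1}\cdots s_{i_N}$ of $w_0$ is adapted to $Q$ if $i_1$ is a sink of $Q$, $i_2$ is a sink of $S_{i_1}Q$, $i_3$ is a sink of $S_{i_2}S_{i_1}Q$, and so on. The Ringel form $R$ of $Q$ is the bilinear form on $E$ with $r_{i,j}:=R(\alpha_i,\alpha_j)$ equal to $1$ if $i=j$, to $-1$ if there is an arrow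 $i\to j$ in $Q$, and to $0$ otherwise. For $i\in I$ put $\rho_i=\sum_{l\in I}r_{l,i}\,\omega_l$, and let $\varphi_R:E\to E$ be the linear map with $\varphi_R(\alpha_i)=\rho_i$ for all $i\in I$. For any reduced expression $\tilde w_0$ of $w_0$, the roots $\beta_1,\dots,\beta_N$ are exactly the positive roots, each occurring once. The weights $\mu_1,\dots,\mu_N$ (the chamber weights) are pairwise distinct. *)

theory Defs
  imports "HOL-Analysis.Analysis" "HOL-Combinatorics.Permutations"
begin

section \<open>Dynkin diagrams of type ADE\<close>

text \<open>
  All these diagrams are simple graphs on the vertex set \<open>{1..n}\<close>, given by their edges, which
  are two-element sets. The standard labellings are those of Bourbaki; a diagram of type ADE is
  one of them up to relabelling. In particular it is connected.
\<close>

definition A_diagram :: "nat \<Rightarrow> nat set set" where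
  "A_diagram n = {{i, i + 1} | i. 1 \<le> i \<and> i < n}"

definition D_diagram :: "nat \<Rightarrow> nat set set" where
  "D_diagram n = {{i, i + 1} | i. 1 \<le> i \<and> i < n - 1} \<union> {{n - 2, n}}"

definition E_diagram :: "nat \<Rightarrow> nat set set" where
  "E_diagram n = {{i, i + 1} | i. 3 \<le> i \<and> i < n} \<union> {{1, 3}, {2, 4}}"

definition ADE_diagram :: "nat \<Rightarrow> nat set set \<Rightarrow> bool" where
  "ADE_diagram n D \<longleftrightarrow>
     (\<exists>\<sigma> S. \<sigma> permutes {1..n} \<and> D = (\<lambda>e. \<sigma> ` e) ` S \<and>
        (n \<ge> 1 \<and> S = A_diagram n \<or> n \<ge> 4 \<and> S = D_diagram n \<or> n \<in> {6, 7, 8} \<and> S = E_diagram n))"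

section \<open>Root systems\<close>

definition root_reflection :: "'a::euclidean_space \<Rightarrow> 'a \<Rightarrow> 'a" where
  "root_reflection \<beta> v = v - (2 * (v \<bullet> \<beta>) / (\<beta> \<bullet> \<beta>)) *\<^sub>R \<beta>"

definition root_system :: "'a::euclidean_space set \<Rightarrow> bool" where
  "root_system \<Phi> \<longleftrightarrow>
     finite \<Phi> \<and> 0 \<notin> \<Phi> \<and> span \<Phi> = UNIV \<and>
     (\<forall>\<beta>\<in>\<Phi>. \<forall>c. c *\<^sub>R \<beta> \<in> \<Phi> \<longleftrightarrow> c = 1 \<or> c = -1) \<and>
     (\<forall>\<beta>\<in>\<Phi>. root_reflection \<beta> ` \<Phi> = \<Phi>) \<and>
     (\<forall>\<beta>\<in>\<Phi>. \<forall>\<gamma>\<in>\<Phi>. 2 * (\<gamma> \<bullet> \<beta>) / (\<beta> \<bullet> \<beta>) \<in> \<int>)"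

definition positive_roots :: "'a::euclidean_space set \<Rightarrow> nat \<Rightarrow> (nat \<Rightarrow> 'a) \<Rightarrow> 'a set" where
  "positive_roots \<Phi> n \<alpha> = {\<beta> \<in> \<Phi>. \<exists>c :: nat \<Rightarrow> nat. \<beta> = (\<Sum>i\<in>{1..n}. real (c i) *\<^sub>R \<alpha> i)}"

text \<open>\<open>\<alpha> 1, \<dots>, \<alpha> n\<close> are the simple roots of a base of \<open>\<Phi>\<close>.\<close>

definition simple_roots :: "'a::euclidean_space set \<Rightarrow> nat \<Rightarrow> (nat \<Rightarrow> 'a) \<Rightarrow> bool" where
  "simple_roots \<Phi> n \<alpha> \<longleftrightarrow>
     \<alpha> ` {1..n} \<subseteq> \<Phi> \<and> inj_on \<alpha> {1..n} \<and> independent (\<alpha> ` {1..n}) \<and> span (\<alpha> ` {1..n}) = UNIV \<and>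
     (\<forall>\<beta>\<in>\<Phi>. \<beta> \<in> positive_roots \<Phi> n \<alpha> \<or> - \<beta> \<in> positive_roots \<Phi> n \<alpha>)"

text \<open>
  In a simply laced Dynkin diagram the Cartan integer of two distinct vertices is \<open>-1\<close> if they
  are adjacent and \<open>0\<close> otherwise. The length of the roots is not normalised.
\<close>

definition has_simply_laced_diagram :: "nat \<Rightarrow> (nat \<Rightarrow> 'a::euclidean_space) \<Rightarrow> nat set set \<Rightarrow> bool" where
  "has_simply_laced_diagram n \<alpha> D \<longleftrightarrow>
     (\<forall>i\<in>{1..n}. \<forall>j\<in>{1..n}. i \<noteq> j \<longrightarrow>
        2 * (\<alpha> i \<bullet> \<alpha> j) / (\<alpha> j \<bullet> \<alpha> j) = (if {i, j} \<in> D then -1 else 0))"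

definition fundamental_weights :: "nat \<Rightarrow> (nat \<Rightarrow> 'a::euclidean_space) \<Rightarrow> (nat \<Rightarrow> 'a) \<Rightarrow> bool" where
  "fundamental_weights n \<alpha> \<omega> \<longleftrightarrow>
     (\<forall>i\<in>{1..n}. \<forall>j\<in>{1..n}. 2 * (\<omega> i \<bullet> \<alpha> j) / (\<alpha> j \<bullet> \<alpha> j) = (if i = j then 1 else 0))"

section \<open>Weyl group and reduced expressions\<close>

text \<open>
  The group generated by all reflections in roots; inverses need not be mentioned since
  reflections are involutions.
\<close>

inductive_set weyl_group :: "'a::euclidean_space set \<Rightarrow> ('a \<Rightarrow> 'a) set" for \<Phi> where
  id: "id \<in> weyl_group \<Phi>"
| reflection: "\<beta> \<in> \<Phi> \<Longrightarrow> w \<in> weyl_group \<Phi> \<Longrightarrow> root_reflection \<beta> \<circ> w \<in> weyl_group \<Phi>"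

text \<open>The list \<open>[i\<^sub>1, \<dots>, i\<^sub>m]\<close> stands for the expression \<open>s\<^bsub>i\<^sub>1\<^esub> \<dots> s\<^bsub>i\<^sub>m\<^esub>\<close>.\<close>

definition word_prod :: "(nat \<Rightarrow> 'a::euclidean_space) \<Rightarrow> nat list \<Rightarrow> 'a \<Rightarrow> 'a" where
  "word_prod \<alpha> is = foldr (\<lambda>i f. root_reflection (\<alpha> i) \<circ> f) is id"

definition weyl_length :: "nat \<Rightarrow> (nat \<Rightarrow> 'a::euclidean_space) \<Rightarrow> ('a \<Rightarrow> 'a) \<Rightarrow> nat" where
  "weyl_length n \<alpha> w = (LEAST m. \<exists>is. set is \<subseteq> {1..n} \<and> length is = m \<and> word_prod \<alpha> is = w)"

definition reduced_expression ::
    "nat \<Rightarrow> (nat \<Rightarrow> 'a::euclidean_space) \<Rightarrow> ('a \<Rightarrow> 'a) \<Rightarrow> nat list \<Rightarrow> bool" where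
  "reduced_expression n \<alpha> w is \<longleftrightarrow>
     set is \<subseteq> {1..n} \<and> word_prod \<alpha> is = w \<and> length is = weyl_length n \<alpha> w"

definition longest_element ::
    "'a::euclidean_space set \<Rightarrow> nat \<Rightarrow> (nat \<Rightarrow> 'a) \<Rightarrow> ('a \<Rightarrow> 'a) \<Rightarrow> bool" where
  "longest_element \<Phi> n \<alpha> w \<longleftrightarrow>
     w \<in> weyl_group \<Phi> \<and> (\<forall>v\<in>weyl_group \<Phi>. weyl_length n \<alpha> v \<le> weyl_length n \<alpha> w)"

text \<open>
  \<open>word_root \<alpha> is k\<close> is the root \<open>\<beta>\<^sub>k\<close> and \<open>chamber_weight \<alpha> \<omega> is k\<close> the weight \<open>\<mu>\<^sub>k\<close>, for
  \<open>1 \<le> k \<le> length is\<close>; the index is 1-based whereas list positions start at 0.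
\<close>

definition word_root :: "(nat \<Rightarrow> 'a::euclidean_space) \<Rightarrow> nat list \<Rightarrow> nat \<Rightarrow> 'a" where
  "word_root \<alpha> is k = word_prod \<alpha> (take (k - 1) is) (\<alpha> (is ! (k - 1)))"

definition chamber_weight ::
    "(nat \<Rightarrow> 'a::euclidean_space) \<Rightarrow> (nat \<Rightarrow> 'a) \<Rightarrow> nat list \<Rightarrow> nat \<Rightarrow> 'a" where
  "chamber_weight \<alpha> \<omega> is k = word_prod \<alpha> (take k is) (\<omega> (is ! (k - 1)))"

text \<open>
  The mapping \<open>\<beta>\<^sub>k \<mapsto> \<mu>\<^sub>k\<close>. It is meaningful on the positive roots for a reduced expression of the
  longest element, as each positive root then is \<open>\<beta>\<^sub>k\<close> for exactly one \<open>k\<close>.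
\<close>

definition chamber_map ::
    "(nat \<Rightarrow> 'a::euclidean_space) \<Rightarrow> (nat \<Rightarrow> 'a) \<Rightarrow> nat list \<Rightarrow> 'a \<Rightarrow> 'a" where
  "chamber_map \<alpha> \<omega> is \<beta> =
     chamber_weight \<alpha> \<omega> is (the_inv_into {1..length is} (word_root \<alpha> is) \<beta>)"

section \<open>Quivers\<close>

text \<open>A quiver is given by its arrows: \<open>(i, j) \<in> Q\<close> is an arrow \<open>i \<rightarrow> j\<close>.\<close>

definition orientation :: "nat set set \<Rightarrow> (nat \<times> nat) set \<Rightarrow> bool" where
  "orientation D Q \<longleftrightarrow>
     (\<forall>i j. {i, j} \<in> D \<longleftrightarrow> (i, j) \<in> Q \<or> (j, i) \<in> Q) \<and>
     (\<forall>i j. (i, j) \<in> Q \<longrightarrow> (j, i) \<notin> Q)"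

definition sink :: "(nat \<times> nat) set \<Rightarrow> nat \<Rightarrow> bool" where
  "sink Q k \<longleftrightarrow> (\<forall>(i, j)\<in>Q. i = k \<or> j = k \<longrightarrow> j = k)"

definition reverse_at :: "nat \<Rightarrow> (nat \<times> nat) set \<Rightarrow> (nat \<times> nat) set" where
  "reverse_at k Q = {(i, j) \<in> Q. j \<noteq> k} \<union> {(k, i) | i. (i, k) \<in> Q}"

fun adapted :: "(nat \<times> nat) set \<Rightarrow> nat list \<Rightarrow> bool" where
  "adapted Q [] \<longleftrightarrow> True"
| "adapted Q (k # is) \<longleftrightarrow> sink Q k \<and> adapted (reverse_at k Q) is"

definition ringel_form ::
    "nat \<Rightarrow> (nat \<Rightarrow> 'a::euclidean_space) \<Rightarrow> (nat \<times> nat) set \<Rightarrow> ('a \<Rightarrow> 'a \<Rightarrow> real) \<Rightarrow> bool" where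
  "ringel_form n \<alpha> Q R \<longleftrightarrow>
     bilinear R \<and>
     (\<forall>i\<in>{1..n}. \<forall>j\<in>{1..n}.
        R (\<alpha> i) (\<alpha> j) = (if i = j then 1 else if (i, j) \<in> Q then -1 else 0))"

definition ringel_map ::
    "nat \<Rightarrow> (nat \<Rightarrow> 'a::euclidean_space) \<Rightarrow> (nat \<Rightarrow> 'a) \<Rightarrow> ('a \<Rightarrow> 'a \<Rightarrow> real) \<Rightarrow> ('a \<Rightarrow> 'a) \<Rightarrow> bool" where
  "ringel_map n \<alpha> \<omega> R \<phi> \<longleftrightarrow>
     linear \<phi> \<and> (\<forall>i\<in>{1..n}. \<phi> (\<alpha> i) = (\<Sum>l\<in>{1..n}. R (\<alpha> l) (\<alpha> i) *\<^sub>R \<omega> l))"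

end

theory Submission
  imports Defs
begin

text \<open>
  In the coordinates \<open>\<langle>x, \<alpha>\<^sub>l\<^sup>\<or>\<rangle>\<close> the map \<open>\<phi>\<^sub>R\<close> has matrix \<open>(r\<^sub>l\<^sub>i)\<close> on the simple roots. If \<open>i\<close> is a sink
  of \<open>Q\<close>, then \<open>s\<^sub>i \<phi>\<^sub>Q s\<^sub>i\<close> is the map belonging to \<open>S\<^sub>iQ\<close> (the Ringel form is compatible with
  reflection functors), and \<open>s\<^sub>i \<omega>\<^sub>i = - \<phi>\<^sub>Q \<alpha>\<^sub>i\<close>. Since prepending a letter \<open>i\<close> to a word applies \<open>s\<^sub>i\<close>
  to all its roots and weights, induction on the word gives \<open>\<mu>\<^sub>k = - \<phi>\<^sub>R \<beta>\<^sub>k\<close> for every adapted word.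
  The exchange property shows that the \<open>\<beta>\<^sub>k\<close> of a reduced word of the longest element enumerate
  the positive roots.
\<close>

section \<open>Words in reflections\<close>

lemma linear_root_reflection: "linear (root_reflection \<beta>)"
  unfolding root_reflection_def
  by (rule linearI) (simp_all add: algebra_simps inner_left_distrib add_divide_distrib)

lemma root_reflection_involution [simp]: "root_reflection \<beta> (root_reflection \<beta> v) = v"
  by (cases "\<beta> = 0") (simp_all add: root_reflection_def inner_diff_left algebra_simps)

lemma root_reflection_self: "root_reflection \<beta> \<beta> = - \<beta>"
  by (cases "\<beta> = 0") (simp_all add: root_reflection_def scaleR_2)

lemma inner_root_reflection: "root_reflection \<beta> v \<bullet> root_reflection \<beta> w = v \<bullet> w"
proof (cases "\<beta> = 0")
  case False
  then show ?thesis
    by (simp add: root_reflection_def inner_diff_left inner_diff_right inner_commute field_simps)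
qed (simp add: root_reflection_def)

text \<open>The reflection formula involves inner products only, so an isometry carries it along
  with its root. This gives w s_i = s_k w whenever w \<alpha>_i = \<alpha>_k, the identity behind
  \<open>exchange\<close>.\<close>

lemma root_reflection_conjugate:
  assumes "linear f" and "\<And>v w. f v \<bullet> f w = v \<bullet> w"
  shows "f (root_reflection \<beta> v) = root_reflection (f \<beta>) (f v)"
  by (simp add: root_reflection_def assms(2) linear_diff[OF assms(1)] linear_cmul[OF assms(1)])

lemma word_prod_Nil [simp]: "word_prod \<alpha> [] = id"
  by (simp add: word_prod_def)

lemma word_prod_Cons [simp]: "word_prod \<alpha> (i # is) = root_reflection (\<alpha> i) \<circ> word_prod \<alpha> is"
  by (simp add: word_prod_def)

lemma word_prod_append [simp]: "word_prod \<alpha> (is @ js) = word_prod \<alpha> is \<circ> word_prod \<alpha> js"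
  by (induction "is") auto

lemma linear_word_prod: "linear (word_prod \<alpha> is)"
proof (induction "is")
  case Nil
  show ?case
    unfolding word_prod_Nil by (rule linear_id)
next
  case (Cons i "is")
  show ?case
    unfolding word_prod_Cons using Cons linear_root_reflection by (rule linear_compose)
qed

lemma inner_word_prod: "word_prod \<alpha> is v \<bullet> word_prod \<alpha> is w = v \<bullet> w"
  by (induction "is") (auto simp: inner_root_reflection)

lemma inj_word_prod: "inj (word_prod \<alpha> is)"
proof (induction "is")
  case (Cons i "is")
  have "inj (root_reflection (\<alpha> i))"
    by (metis injI root_reflection_involution)
  then show ?case
    unfolding word_prod_Cons using Cons by (rule inj_compose)
qed simp

section \<open>Roots and weights along a word\<close>

lemma word_root_Cons_1: "word_root \<alpha> (i # is) (Suc 0) = \<alpha> i"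
  by (simp add: word_root_def)

text \<open>Each nonempty prefix of the longer word begins with i. The bound on k matters: at k = 0
  the truncated \<open>k - 1\<close> would read the first letter of \<open>is\<close>.\<close>

lemma word_root_Cons_Suc:
  assumes "k \<ge> 1"
  shows "word_root \<alpha> (i # is) (Suc k) = root_reflection (\<alpha> i) (word_root \<alpha> is k)"
  using assms by (cases k) (simp_all add: word_root_def)

lemma chamber_weight_Cons_Suc:
  assumes "k \<ge> 1"
  shows "chamber_weight \<alpha> \<omega> (i # is) (Suc k) = root_reflection (\<alpha> i) (chamber_weight \<alpha> \<omega> is k)"
  using assms by (cases k) (simp_all add: chamber_weight_def)

text \<open>Minimality is expressed by comparison with all competing words rather than through
  \<open>weyl_length\<close>, so that it passes directly to infixes.\<close>

definition minimal_word :: "nat \<Rightarrow> (nat \<Rightarrow> 'a::euclidean_space) \<Rightarrow> nat list \<Rightarrow> bool" where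
  "minimal_word n \<alpha> is \<longleftrightarrow> set is \<subseteq> {1..n} \<and>
     (\<forall>js. set js \<subseteq> {1..n} \<and> word_prod \<alpha> js = word_prod \<alpha> is \<longrightarrow> length is \<le> length js)"

lemma reduced_expression_minimal_word:
  assumes "reduced_expression n \<alpha> w is"
  shows "minimal_word n \<alpha> is"
  using assms unfolding minimal_word_def reduced_expression_def weyl_length_def
  by (auto intro!: Least_le)

lemma reduced_expression_exists:
  assumes "set is \<subseteq> {1..n}"
  shows "\<exists>js. reduced_expression n \<alpha> (word_prod \<alpha> is) js"
proof -
  let ?P = "\<lambda>m. \<exists>js. set js \<subseteq> {1..n} \<and> length js = m \<and> word_prod \<alpha> js = word_prod \<alpha> is"
  have "?P (LEAST m. ?P m)"
    using assms by (intro LeastI[of ?P "length is"]) auto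
  then show ?thesis
    unfolding reduced_expression_def weyl_length_def by blast
qed

lemma take_nth_drop:
  assumes "k \<in> {1..length xs}"
  shows "take (k - 1) xs @ [xs ! (k - 1)] @ drop k xs = xs"
proof -
  have "k - 1 < length xs" and k: "Suc (k - 1) = k"
    using assms by auto
  from id_take_nth_drop[OF this(1)] show ?thesis
    unfolding k by simp
qed

text \<open>A shorter word for the infix could be spliced in and would shorten the whole
  word.\<close>

lemma minimal_word_infix:
  assumes "minimal_word n \<alpha> (xs @ ys @ zs)"
  shows "minimal_word n \<alpha> ys"
  unfolding minimal_word_def
proof (intro conjI allI impI)
  show "set ys \<subseteq> {1..n}"
    using assms by (auto simp: minimal_word_def)
  fix js assume js: "set js \<subseteq> {1..n} \<and> word_prod \<alpha> js = word_prod \<alpha> ys"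
  then have "set (xs @ js @ zs) \<subseteq> {1..n}" "word_prod \<alpha> (xs @ js @ zs) = word_prod \<alpha> (xs @ ys @ zs)"
    using assms by (auto simp: minimal_word_def)
  then have "length (xs @ ys @ zs) \<le> length (xs @ js @ zs)"
    using assms unfolding minimal_word_def by blast
  then show "length ys \<le> length js"
    by simp
qed

section \<open>Positive roots and the exchange property\<close>

locale simple_root_system =
  fixes \<Phi> :: "'a::euclidean_space set" and n :: nat and \<alpha> :: "nat \<Rightarrow> 'a"
  assumes root_system: "root_system \<Phi>" and simple_roots: "simple_roots \<Phi> n \<alpha>"
begin

abbreviation "pos \<equiv> positive_roots \<Phi> n \<alpha>"
abbreviation "s i \<equiv> root_reflection (\<alpha> i)"

lemma simple_root_in: "i \<in> {1..n} \<Longrightarrow> \<alpha> i \<in> \<Phi>"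
  using simple_roots by (auto simp: simple_roots_def)

lemma simple_root_coefficients:
  assumes "(\<Sum>j\<in>{1..n}. f j *\<^sub>R \<alpha> j) = (\<Sum>j\<in>{1..n}. g j *\<^sub>R \<alpha> j)" and "j \<in> {1..n}"
  shows "f j = g j"
proof -
  have inj: "inj_on \<alpha> {1..n}" and ind: "independent (\<alpha> ` {1..n})"
    using simple_roots by (auto simp: simple_roots_def)
  \<comment> \<open>\<open>independentD\<close> takes coefficients indexed by vectors, so the
    differences of f and g are transported along the inverse of \<alpha>.\<close>
  define h where "h v = (let j = the_inv_into {1..n} \<alpha> v in f j - g j)" for v
  have h: "h (\<alpha> j) = f j - g j" if "j \<in> {1..n}" for j
    by (simp only: h_def the_inv_into_f_f[OF inj that] Let_def)
  have "(\<Sum>v\<in>\<alpha> ` {1..n}. h v *\<^sub>R v) = (\<Sum>j\<in>{1..n}. h (\<alpha> j) *\<^sub>R \<alpha> j)"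
    by (simp only: sum.reindex[OF inj] o_def)
  also have "\<dots> = (\<Sum>j\<in>{1..n}. (f j - g j) *\<^sub>R \<alpha> j)"
    by (intro sum.cong) (simp_all add: h)
  also have "\<dots> = 0"
    using assms(1) by (simp add: scaleR_diff_left sum_subtractf)
  finally have "h (\<alpha> j) = 0"
    using independentD[OF ind, of "\<alpha> ` {1..n}" h "\<alpha> j"] assms(2) by auto
  with h[OF assms(2)] show ?thesis by simp
qed

lemma root_nonzero: "\<beta> \<in> \<Phi> \<Longrightarrow> \<beta> \<noteq> 0"
  using root_system by (auto simp: root_system_def)

lemma pos_subset: "\<beta> \<in> pos \<Longrightarrow> \<beta> \<in> \<Phi>"
  by (simp add: positive_roots_def)

lemma uminus_root: "\<beta> \<in> \<Phi> \<Longrightarrow> - \<beta> \<in> \<Phi>"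
  using root_system unfolding root_system_def by (metis scaleR_minus1_left)

lemma pos_or_neg: "\<beta> \<in> \<Phi> \<Longrightarrow> \<beta> \<in> pos \<or> - \<beta> \<in> pos"
  using simple_roots by (simp add: simple_roots_def)

text \<open>Otherwise the coefficients of \<beta> would be both nonnegative and nonpositive, hence
  all 0, but 0 is not a root.\<close>

lemma pos_not_neg:
  assumes "\<beta> \<in> pos"
  shows "- \<beta> \<notin> pos"
proof
  assume "- \<beta> \<in> pos"
  then obtain d :: "nat \<Rightarrow> nat" where d: "- \<beta> = (\<Sum>i\<in>{1..n}. real (d i) *\<^sub>R \<alpha> i)"
    by (auto simp: positive_roots_def)
  obtain c :: "nat \<Rightarrow> nat" where c: "\<beta> = (\<Sum>i\<in>{1..n}. real (c i) *\<^sub>R \<alpha> i)"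
    using assms by (auto simp: positive_roots_def)
  have eq: "(\<Sum>i\<in>{1..n}. real (c i) *\<^sub>R \<alpha> i) = (\<Sum>i\<in>{1..n}. (- real (d i)) *\<^sub>R \<alpha> i)"
    by (simp only: scaleR_minus_left sum_negf c[symmetric] d[symmetric] minus_minus)
  have "c i = 0" if "i \<in> {1..n}" for i
    using simple_root_coefficients[OF eq that] by linarith
  then have "\<beta> = 0"
    using c by simp
  then show False
    using root_nonzero pos_subset assms by blast
qed

lemma simple_root_pos:
  assumes "i \<in> {1..n}"
  shows "\<alpha> i \<in> pos"
proof -
  have "\<alpha> i = (\<Sum>j\<in>{1..n}. real (if j = i then 1 else 0) *\<^sub>R \<alpha> j)"
    using assms by (simp add: if_distrib[of real] if_distrib[of "\<lambda>x. x *\<^sub>R _"] cong: if_cong)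
  then show ?thesis
    unfolding positive_roots_def using simple_root_in[OF assms]
    by (intro CollectI conjI exI[of _ "\<lambda>j. if j = i then 1 else 0"])
qed

lemma reflection_root: "\<beta> \<in> \<Phi> \<Longrightarrow> root_reflection \<beta> ` \<Phi> = \<Phi>"
  using root_system by (simp add: root_system_def)

lemma word_prod_roots: "set is \<subseteq> {1..n} \<Longrightarrow> word_prod \<alpha> is ` \<Phi> = \<Phi>"
proof (induction "is")
  case (Cons i "is")
  then show ?case
    using reflection_root[OF simple_root_in[of i]] unfolding word_prod_Cons image_comp[symmetric] by simp
qed simp

lemma word_prod_weyl_group: "set is \<subseteq> {1..n} \<Longrightarrow> word_prod \<alpha> is \<in> weyl_group \<Phi>"
proof (induction "is")
  case Nil
  then show ?case
    unfolding word_prod_Nil by (intro weyl_group.id)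
next
  case (Cons i "is")
  then show ?case
    unfolding word_prod_Cons using simple_root_in[of i] by (intro weyl_group.reflection) auto
qed

text \<open>s_i alters only the coefficient of \<alpha>_i. If the image were negative, all other
  coefficients of \<beta> would vanish, making \<beta> a multiple of \<alpha>_i.\<close>

lemma simple_reflection_pos:
  assumes "\<beta> \<in> pos" and "i \<in> {1..n}" and "\<beta> \<noteq> \<alpha> i"
  shows "s i \<beta> \<in> pos"
proof (rule ccontr)
  assume "s i \<beta> \<notin> pos"
  moreover have "s i \<beta> \<in> \<Phi>"
    using reflection_root[OF simple_root_in[OF assms(2)]] pos_subset[OF assms(1)] by blast
  ultimately have "- s i \<beta> \<in> pos"
    using pos_or_neg by blast
  then obtain d :: "nat \<Rightarrow> nat" where d: "- s i \<beta> = (\<Sum>j\<in>{1..n}. real (d j) *\<^sub>R \<alpha> j)"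
    by (auto simp: positive_roots_def)
  obtain c :: "nat \<Rightarrow> nat" where c: "\<beta> = (\<Sum>j\<in>{1..n}. real (c j) *\<^sub>R \<alpha> j)"
    using assms(1) by (auto simp: positive_roots_def)
  define t where "t = 2 * (\<beta> \<bullet> \<alpha> i) / (\<alpha> i \<bullet> \<alpha> i)"
  have single: "(\<Sum>j\<in>{1..n}. (if j = i then x else 0) *\<^sub>R \<alpha> j) = x *\<^sub>R \<alpha> i" for x
    using assms(2) by (simp add: if_distrib[of "\<lambda>x. x *\<^sub>R _"] cong: if_cong)
  \<comment> \<open>The difference \<beta> - s_i \<beta> = t \<alpha>_i is expanded in two ways;
    away from i the sum of the natural numbers \<open>c j\<close> and \<open>d j\<close> must be
    0.\<close>
  have eq: "(\<Sum>j\<in>{1..n}. (real (c j) + real (d j)) *\<^sub>R \<alpha> j) =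
      (\<Sum>j\<in>{1..n}. (if j = i then t else 0) *\<^sub>R \<alpha> j)"
    unfolding single scaleR_add_left sum.distrib c[symmetric] d[symmetric]
    by (simp add: root_reflection_def t_def)
  have "c j = 0" if "j \<in> {1..n}" "j \<noteq> i" for j
    using simple_root_coefficients[OF eq that(1)] that(2) by simp
  then have "\<beta> = (\<Sum>j\<in>{1..n}. (if j = i then real (c i) else 0) *\<^sub>R \<alpha> j)"
    unfolding c by (intro sum.cong) auto
  then have \<beta>: "\<beta> = real (c i) *\<^sub>R \<alpha> i"
    unfolding single .
  then have "real (c i) *\<^sub>R \<alpha> i \<in> \<Phi>"
    using pos_subset[OF assms(1)] by simp
  \<comment> \<open>The only multiples of a root that are roots are itself and its negative, and
    \<open>c i\<close> is a natural number.\<close>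
  then have "real (c i) = 1 \<or> real (c i) = -1"
    using root_system simple_root_in[OF assms(2)] unfolding root_system_def by blast
  then have "real (c i) = 1"
    by linarith
  then show False
    using \<beta> assms(3) by simp
qed

text \<open>Following \<alpha>_i through the word from the right, its sign flips at some letter k.
  Just before the flip the root is \<alpha>_k, so s_k can be moved to the right end, where it
  becomes s_i and cancels the appended one: what remains is the word with k deleted.\<close>

lemma exchange:
  assumes "set js \<subseteq> {1..n}" and "i \<in> {1..n}" and "- word_prod \<alpha> js (\<alpha> i) \<in> pos"
  shows "\<exists>ks. set ks \<subseteq> {1..n} \<and> Suc (length ks) = length js \<and>
    word_prod \<alpha> ks = word_prod \<alpha> js \<circ> s i"
  using assms
proof (induction js)
  case Nil
  then show ?case
    using pos_not_neg[OF simple_root_pos] by simp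
next
  case (Cons k js)
  let ?\<gamma> = "word_prod \<alpha> js (\<alpha> i)"
  have k: "k \<in> {1..n}" and js: "set js \<subseteq> {1..n}"
    using Cons.prems by auto
  show ?case
  proof (cases "- ?\<gamma> \<in> pos")
    case True
    then obtain ks where ks: "set ks \<subseteq> {1..n}" "Suc (length ks) = length js"
        "word_prod \<alpha> ks = word_prod \<alpha> js \<circ> s i"
      using Cons.IH js Cons.prems(2) by blast
    then show ?thesis
      using k by (intro exI[of _ "k # ks"]) (auto simp: o_assoc)
  next
    case False
    have "?\<gamma> \<in> \<Phi>"
      using word_prod_roots[OF js] simple_root_in[OF Cons.prems(2)] by blast
    then have "?\<gamma> \<in> pos"
      using False pos_or_neg by blast
    moreover have "s k ?\<gamma> \<notin> pos"
      using pos_not_neg Cons.prems(3) by auto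
    \<comment> \<open>The letter k turns the positive root \<open>?\<gamma>\<close> negative, which
      s_k does to \<alpha>_k alone.\<close>
    ultimately have "?\<gamma> = \<alpha> k"
      using simple_reflection_pos k by blast
    then have "word_prod \<alpha> js (s i v) = s k (word_prod \<alpha> js v)" for v
      using root_reflection_conjugate[OF linear_word_prod inner_word_prod, of \<alpha> js "\<alpha> i" v]
      by simp
    then have eq: "word_prod \<alpha> js = word_prod \<alpha> (k # js) \<circ> s i"
      by (simp add: fun_eq_iff)
    show ?thesis
      by (intro exI[of _ js] conjI js eq) simp
  qed
qed

section \<open>The roots of a minimal word are positive and distinct\<close>

lemma minimal_word_snoc_pos:
  assumes "minimal_word n \<alpha> (js @ [i])"
  shows "word_prod \<alpha> js (\<alpha> i) \<in> pos"
proof (rule ccontr)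
  assume not_pos: "word_prod \<alpha> js (\<alpha> i) \<notin> pos"
  have js: "set js \<subseteq> {1..n}" and i: "i \<in> {1..n}"
    using assms by (auto simp: minimal_word_def)
  have "word_prod \<alpha> js (\<alpha> i) \<in> \<Phi>"
    using word_prod_roots[OF js] simple_root_in[OF i] by blast
  \<comment> \<open>If the root were negative, exchange would give a word for the same element with
    two letters fewer.\<close>
  then obtain ks where ks: "set ks \<subseteq> {1..n}" "Suc (length ks) = length js"
      "word_prod \<alpha> ks = word_prod \<alpha> js \<circ> s i"
    using exchange[OF js i] pos_or_neg not_pos by blast
  have "word_prod \<alpha> ks = word_prod \<alpha> (js @ [i])"
    using ks(3) by simp
  then have "length (js @ [i]) \<le> length ks"
    using assms ks(1) unfolding minimal_word_def by blast
  then show False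
    using ks(2) by simp
qed

lemma word_root_pos:
  assumes "minimal_word n \<alpha> is" and "k \<in> {1..length is}"
  shows "word_root \<alpha> is k \<in> pos"
proof -
  have "minimal_word n \<alpha> ([] @ (take (k - 1) is @ [is ! (k - 1)]) @ drop k is)"
    using assms(1) by (simp only: append_Nil append_assoc take_nth_drop[OF assms(2)])
  then have "minimal_word n \<alpha> (take (k - 1) is @ [is ! (k - 1)])"
    by (rule minimal_word_infix)
  then show ?thesis
    unfolding word_root_def by (rule minimal_word_snoc_pos)
qed

text \<open>Cancelling the common prefix from an equality of two roots shows that u sends the k-th
  simple root of the word to the negative of the j-th one, where u consists of the letters strictly
  between. But u followed by the k-th letter is an infix of a minimal word, so that image is
  positive.\<close>

lemma word_root_neq:
  assumes "minimal_word n \<alpha> is" and "1 \<le> j" "j < k" "k \<le> length is"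
  shows "word_root \<alpha> is j \<noteq> word_root \<alpha> is k"
proof
  assume eq: "word_root \<alpha> is j = word_root \<alpha> is k"
  define u where "u = drop j (take (k - 1) is)"
  have "j - 1 < length is"
    using assms(2-4) by linarith
  then have j: "is ! (j - 1) \<in> {1..n}"
    using nth_mem assms(1) unfolding minimal_word_def by blast
  have "take (k - 1) is = take j (take (k - 1) is) @ u"
    by (simp only: u_def append_take_drop_id)
  also have "take j (take (k - 1) is) = take (Suc (j - 1)) is"
    using assms(2,3) by (simp add: min_absorb1 del: One_nat_def)
  also have "\<dots> = take (j - 1) is @ [is ! (j - 1)]"
    using \<open>j - 1 < length is\<close> by (rule take_Suc_conv_app_nth)
  finally have split: "take (k - 1) is = take (j - 1) is @ [is ! (j - 1)] @ u"
    by simp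
  have "take (k - 1) is @ [is ! (k - 1)] @ drop k is = is"
    using assms(2-4) by (intro take_nth_drop) simp
  then have "(take (j - 1) is @ [is ! (j - 1)]) @ (u @ [is ! (k - 1)]) @ drop k is = is"
    by (simp only: split append_assoc)
  then have "minimal_word n \<alpha> ((take (j - 1) is @ [is ! (j - 1)]) @ (u @ [is ! (k - 1)]) @ drop k is)"
    using assms(1) by (simp only:)
  then have "minimal_word n \<alpha> (u @ [is ! (k - 1)])"
    by (rule minimal_word_infix)
  then have pos: "word_prod \<alpha> u (\<alpha> (is ! (k - 1))) \<in> pos"
    by (rule minimal_word_snoc_pos)
  have "\<alpha> (is ! (j - 1)) = s (is ! (j - 1)) (word_prod \<alpha> u (\<alpha> (is ! (k - 1))))"
    using eq inj_word_prod[of \<alpha> "take (j - 1) is"]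
    unfolding word_root_def split by (simp add: inj_eq)
  then have "word_prod \<alpha> u (\<alpha> (is ! (k - 1))) = - \<alpha> (is ! (j - 1))"
    by (metis root_reflection_involution root_reflection_self)
  then show False
    using pos pos_not_neg[OF simple_root_pos[OF j]] by simp
qed

section \<open>Inversions of a word and the longest element\<close>

lemma inversion_word_root:
  assumes "set is \<subseteq> {1..n}" and "\<beta> \<in> pos" and "\<gamma> \<in> pos" and "\<beta> = - word_prod \<alpha> is \<gamma>"
  shows "\<exists>k\<in>{1..length is}. \<beta> = word_root \<alpha> is k"
  using assms
proof (induction "is" arbitrary: \<beta>)
  case Nil
  then show ?case
    using pos_not_neg by auto
next
  case (Cons i "is")
  show ?case
  proof (cases "\<beta> = \<alpha> i")
    case True
    then show ?thesis
      by (intro bexI[of _ "Suc 0"]) (auto simp: word_root_Cons_1)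
  next
    case False
    \<comment> \<open>With the first letter dropped, s_i \<beta> is an inversion of the remaining
      word; it stays positive because \<beta> is not \<alpha>_i.\<close>
    have "s i \<beta> = - word_prod \<alpha> is \<gamma>"
      using Cons.prems(4) by (simp add: linear_neg[OF linear_root_reflection])
    moreover have "s i \<beta> \<in> pos"
      using simple_reflection_pos Cons.prems False by simp
    ultimately obtain k where k: "k \<in> {1..length is}" "s i \<beta> = word_root \<alpha> is k"
      using Cons.IH[of "s i \<beta>"] Cons.prems by auto
    have "\<beta> = s i (s i \<beta>)"
      by simp
    also have "\<dots> = word_root \<alpha> (i # is) (Suc k)"
      using k by (simp add: word_root_Cons_Suc)
    finally show ?thesis
      using k(1) by (intro bexI[of _ "Suc k"]) auto
  qed
qed

text \<open>If w \<alpha>_i were positive, a reduced word of w s_i would send \<alpha>_i to a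
  negative root. Exchange then yields a word for w that is shorter than this one, whose length is at
  most that of w by maximality.\<close>

lemma longest_element_neg_simple:
  assumes "longest_element \<Phi> n \<alpha> w" and "reduced_expression n \<alpha> w is" and i: "i \<in> {1..n}"
  shows "- w (\<alpha> i) \<in> pos"
proof -
  have "is": "set is \<subseteq> {1..n}" and w: "w = word_prod \<alpha> is" and len: "length is = weyl_length n \<alpha> w"
    using assms(2) by (auto simp: reduced_expression_def)
  have is_i: "set (is @ [i]) \<subseteq> {1..n}"
    using "is" i by simp
  \<comment> \<open>A reduced word is taken instead of \<open>is @ [i]\<close>: exchange on the
    latter would only return a word as long as \<open>is\<close>.\<close>
  obtain js where js: "reduced_expression n \<alpha> (word_prod \<alpha> (is @ [i])) js"
    using reduced_expression_exists[OF is_i] by blast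
  then have js_set: "set js \<subseteq> {1..n}" and js_prod: "word_prod \<alpha> js = w \<circ> s i"
    by (auto simp: reduced_expression_def w)
  have js_len: "length js \<le> length is"
    using assms(1) js word_prod_weyl_group[OF is_i] len
    by (auto simp: longest_element_def reduced_expression_def)
  have js_\<alpha>: "word_prod \<alpha> js (\<alpha> i) = - w (\<alpha> i)"
    unfolding js_prod by (simp add: root_reflection_self w linear_neg[OF linear_word_prod])
  have "w (\<alpha> i) \<notin> pos"
  proof
    assume "w (\<alpha> i) \<in> pos"
    then have "- word_prod \<alpha> js (\<alpha> i) \<in> pos"
      by (simp add: js_\<alpha>)
    then obtain ks where ks: "set ks \<subseteq> {1..n}" "Suc (length ks) = length js"
        "word_prod \<alpha> ks = word_prod \<alpha> js \<circ> s i"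
      using exchange[OF js_set i] by blast
    have "word_prod \<alpha> ks = word_prod \<alpha> is"
      unfolding ks(3) js_prod by (simp add: fun_eq_iff w)
    then have "length is \<le> length ks"
      using reduced_expression_minimal_word[OF assms(2)] ks(1) unfolding minimal_word_def by blast
    then show False
      using ks(2) js_len by simp
  qed
  moreover have "w (\<alpha> i) \<in> \<Phi>"
    using word_prod_roots[OF "is"] simple_root_in[OF i] w by blast
  ultimately show ?thesis
    using pos_or_neg by blast
qed

lemma longest_element_neg:
  assumes "longest_element \<Phi> n \<alpha> w" and "reduced_expression n \<alpha> w is" and "\<gamma> \<in> pos"
  shows "- w \<gamma> \<in> pos"
proof -
  have "is": "set is \<subseteq> {1..n}" and w: "w = word_prod \<alpha> is"
    using assms(2) by (auto simp: reduced_expression_def)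
  obtain c :: "nat \<Rightarrow> nat" where c: "\<gamma> = (\<Sum>i\<in>{1..n}. real (c i) *\<^sub>R \<alpha> i)"
    using assms(3) by (auto simp: positive_roots_def)
  have "\<forall>i\<in>{1..n}. \<exists>d :: nat \<Rightarrow> nat. - w (\<alpha> i) = (\<Sum>j\<in>{1..n}. real (d j) *\<^sub>R \<alpha> j)"
    using longest_element_neg_simple[OF assms(1,2)] by (auto simp: positive_roots_def)
  then obtain d :: "nat \<Rightarrow> nat \<Rightarrow> nat"
    where d: "\<And>i. i \<in> {1..n} \<Longrightarrow> - w (\<alpha> i) = (\<Sum>j\<in>{1..n}. real (d i j) *\<^sub>R \<alpha> j)"
    by metis
  have "- w \<gamma> = (\<Sum>i\<in>{1..n}. real (c i) *\<^sub>R (- w (\<alpha> i)))"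
    unfolding c w
    by (simp add: linear_sum[OF linear_word_prod] linear_cmul[OF linear_word_prod] sum_negf)
  also have "\<dots> = (\<Sum>i\<in>{1..n}. \<Sum>j\<in>{1..n}. (real (c i) * real (d i j)) *\<^sub>R \<alpha> j)"
    by (intro sum.cong refl) (simp only: d scaleR_sum_right scaleR_scaleR)
  \<comment> \<open>Collecting the terms in the other order exhibits natural numbers as
    coefficients, as \<open>positive_roots\<close> demands.\<close>
  also have "\<dots> = (\<Sum>j\<in>{1..n}. real (\<Sum>i\<in>{1..n}. c i * d i j) *\<^sub>R \<alpha> j)"
    by (subst sum.swap) (simp add: scaleR_sum_left)
  finally have sum: "- w \<gamma> = (\<Sum>j\<in>{1..n}. real (\<Sum>i\<in>{1..n}. c i * d i j) *\<^sub>R \<alpha> j)" .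
  have "w \<gamma> \<in> \<Phi>"
    using word_prod_roots[OF "is"] pos_subset[OF assms(3)] w by blast
  then have "- w \<gamma> \<in> \<Phi>"
    by (rule uminus_root)
  then show ?thesis
    unfolding positive_roots_def using sum
    by (intro CollectI conjI exI[of _ "\<lambda>j. \<Sum>i\<in>{1..n}. c i * d i j"])
qed

lemma bij_betw_word_root_longest:
  assumes "longest_element \<Phi> n \<alpha> w" and "reduced_expression n \<alpha> w is"
  shows "bij_betw (word_root \<alpha> is) {1..length is} pos"
proof (rule bij_betwI')
  have "is": "set is \<subseteq> {1..n}" and w: "w = word_prod \<alpha> is"
    using assms(2) by (auto simp: reduced_expression_def)
  have min: "minimal_word n \<alpha> is"
    using reduced_expression_minimal_word[OF assms(2)] .
  show "word_root \<alpha> is j = word_root \<alpha> is k \<longleftrightarrow> j = k"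
    if "j \<in> {1..length is}" "k \<in> {1..length is}" for j k
    using word_root_neq[OF min, of j k] word_root_neq[OF min, of k j] that
    by (cases j k rule: linorder_cases) auto
  show "word_root \<alpha> is k \<in> pos" if "k \<in> {1..length is}" for k
    using word_root_pos[OF min that] .
  \<comment> \<open>Surjectivity: \<beta> = w \<delta> with \<delta> negative, since w makes every
    positive root negative. So \<beta> is an inversion of the word.\<close>
  fix \<beta> assume \<beta>: "\<beta> \<in> pos"
  then obtain \<delta> where \<delta>: "\<delta> \<in> \<Phi>" "\<beta> = w \<delta>"
    using word_prod_roots[OF "is"] pos_subset w by blast
  have "\<delta> \<notin> pos"
    using longest_element_neg[OF assms, of \<delta>] pos_not_neg[OF \<beta>] \<delta>(2) by blast
  then have "- \<delta> \<in> pos"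
    using pos_or_neg[OF \<delta>(1)] by blast
  moreover have "\<beta> = - word_prod \<alpha> is (- \<delta>)"
    using \<delta>(2) w by (simp add: linear_neg[OF linear_word_prod])
  ultimately show "\<exists>k\<in>{1..length is}. \<beta> = word_root \<alpha> is k"
    using inversion_word_root[OF "is" \<beta>] by blast
qed

end

section \<open>The Ringel form under reflection at a sink\<close>

text \<open>The pairing with the coroot of \<beta>. Taken against the simple roots it gives the
  coordinates with respect to the fundamental weights.\<close>

definition pairing :: "'a::euclidean_space \<Rightarrow> 'a \<Rightarrow> real" where
  "pairing x \<beta> = 2 * (x \<bullet> \<beta>) / (\<beta> \<bullet> \<beta>)"

lemma pairing_diff: "pairing (x - y) \<beta> = pairing x \<beta> - pairing y \<beta>"
  by (simp add: pairing_def inner_diff_left diff_divide_distrib right_diff_distrib)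

lemma pairing_scaleR: "pairing (c *\<^sub>R x) \<beta> = c * pairing x \<beta>"
  by (simp add: pairing_def)

lemma pairing_minus: "pairing (- x) \<beta> = - pairing x \<beta>"
  by (simp add: pairing_def)

lemma pairing_sum: "pairing (\<Sum>i\<in>I. f i) \<beta> = (\<Sum>i\<in>I. pairing (f i) \<beta>)"
  by (simp add: pairing_def inner_sum_left sum_distrib_left sum_divide_distrib)

lemma root_reflection_pairing: "root_reflection \<beta> x = x - pairing x \<beta> *\<^sub>R \<beta>"
  by (simp add: root_reflection_def pairing_def)

text \<open>The Ringel coefficient \<open>r\<^sub>l\<^sub>i\<close> read off the quiver, so that it
  is available for every reorientation met along the word.\<close>

definition euler_coeff :: "(nat \<times> nat) set \<Rightarrow> nat \<Rightarrow> nat \<Rightarrow> real" where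
  "euler_coeff Q l i = (if l = i then 1 else if (l, i) \<in> Q then -1 else 0)"

text \<open>Characterises the Ringel map by its matrix in weight coordinates, a form that can be
  carried from Q to \<open>reverse_at i Q\<close>.\<close>

definition quiver_map :: "nat \<Rightarrow> (nat \<Rightarrow> 'a::euclidean_space) \<Rightarrow> (nat \<times> nat) set \<Rightarrow> ('a \<Rightarrow> 'a) \<Rightarrow> bool" where
  "quiver_map n \<alpha> Q \<phi> \<longleftrightarrow>
     linear \<phi> \<and> (\<forall>i\<in>{1..n}. \<forall>l\<in>{1..n}. pairing (\<phi> (\<alpha> i)) (\<alpha> l) = euler_coeff Q l i)"

lemma orientation_reverse_at:
  assumes "orientation D Q"
  shows "orientation D (reverse_at k Q)"
proof -
  have "(i, j) \<in> reverse_at k Q \<or> (j, i) \<in> reverse_at k Q \<longleftrightarrow> (i, j) \<in> Q \<or> (j, i) \<in> Q" for i j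
    by (auto simp: reverse_at_def)
  moreover have "(j, i) \<notin> reverse_at k Q" if "(i, j) \<in> reverse_at k Q" for i j
    using that assms by (auto simp: reverse_at_def orientation_def)
  ultimately show ?thesis
    using assms unfolding orientation_def by blast
qed

lemma sink_arrows:
  assumes "orientation D Q" and "sink Q i"
  shows "(i, j) \<notin> Q" and "(j, i) \<in> Q \<longleftrightarrow> {i, j} \<in> D"
proof -
  \<comment> \<open>Being a sink leaves only a loop at i, which the antisymmetry in
    \<open>orientation\<close> rules out.\<close>
  show 1: "(i, j) \<notin> Q"
    using assms by (force simp: orientation_def sink_def)
  show "(j, i) \<in> Q \<longleftrightarrow> {i, j} \<in> D"
    using assms(1) 1 by (simp add: orientation_def)
qed

locale simply_laced =
  fixes n :: nat and \<alpha> :: "nat \<Rightarrow> 'a::euclidean_space" and \<omega> :: "nat \<Rightarrow> 'a" and D :: "nat set set"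
  assumes span: "span (\<alpha> ` {1..n}) = UNIV"
    and nonzero: "i \<in> {1..n} \<Longrightarrow> \<alpha> i \<noteq> 0"
    and diagram: "has_simply_laced_diagram n \<alpha> D"
    and weights: "fundamental_weights n \<alpha> \<omega>"
begin

text \<open>The difference is orthogonal to a spanning set, hence to itself.\<close>

lemma pairing_eqI:
  assumes "\<And>l. l \<in> {1..n} \<Longrightarrow> pairing x (\<alpha> l) = pairing y (\<alpha> l)"
  shows "x = y"
proof -
  have "(x - y) \<bullet> \<alpha> l = 0" if "l \<in> {1..n}" for l
    using assms[OF that] nonzero[OF that] by (simp add: pairing_def inner_diff_left)
  then have "orthogonal (x - y) v" if "v \<in> \<alpha> ` {1..n}" for v
    using that by (auto simp: orthogonal_def)
  moreover have "x - y \<in> span (\<alpha> ` {1..n})"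
    using span by blast
  ultimately have "orthogonal (x - y) (x - y)"
    using orthogonal_to_span by blast
  then show ?thesis
    by (simp add: orthogonal_def)
qed

lemma pairing_simple:
  assumes "i \<in> {1..n}" "l \<in> {1..n}"
  shows "pairing (\<alpha> i) (\<alpha> l) = (if i = l then 2 else if {i, l} \<in> D then -1 else 0)"
  using assms diagram nonzero unfolding has_simply_laced_diagram_def pairing_def by auto

lemma pairing_weight:
  "i \<in> {1..n} \<Longrightarrow> l \<in> {1..n} \<Longrightarrow> pairing (\<omega> i) (\<alpha> l) = (if i = l then 1 else 0)"
  using weights unfolding fundamental_weights_def pairing_def by blast

lemma ringel_map_quiver_map:
  assumes "ringel_form n \<alpha> Q R" and "ringel_map n \<alpha> \<omega> R \<phi>"
  shows "quiver_map n \<alpha> Q \<phi>"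
proof -
  have "pairing (\<phi> (\<alpha> i)) (\<alpha> l) = euler_coeff Q l i" if i: "i \<in> {1..n}" and l: "l \<in> {1..n}" for i l
  proof -
    have "pairing (\<phi> (\<alpha> i)) (\<alpha> l) = (\<Sum>k\<in>{1..n}. R (\<alpha> k) (\<alpha> i) * pairing (\<omega> k) (\<alpha> l))"
      using assms(2) i by (simp add: ringel_map_def pairing_sum pairing_scaleR)
    also have "\<dots> = (\<Sum>k\<in>{1..n}. if k = l then R (\<alpha> k) (\<alpha> i) else 0)"
      using l by (intro sum.cong) (simp_all add: pairing_weight)
    also have "\<dots> = R (\<alpha> l) (\<alpha> i)"
      using l by simp
    also have "\<dots> = euler_coeff Q l i"
      using assms(1) i l by (simp add: ringel_form_def euler_coeff_def)
    finally show ?thesis .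
  qed
  then show ?thesis
    using assms(2) by (simp add: quiver_map_def ringel_map_def)
qed

text \<open>No arrow leaves a sink, so row i is trivial. The Ringel matrix plus its transpose is the
  Cartan matrix, so column i carries all the Cartan integers at i.\<close>

lemma euler_coeff_sink:
  assumes "orientation D Q" and "sink Q i" and "i \<in> {1..n}" and "l \<in> {1..n}"
  shows "euler_coeff Q i l = (if l = i then 1 else 0)"
    and "euler_coeff Q l i = pairing (\<alpha> i) (\<alpha> l) - (if l = i then 1 else 0)"
proof -
  note Q = sink_arrows[OF assms(1,2)]
  show "euler_coeff Q i l = (if l = i then 1 else 0)"
    by (auto simp: euler_coeff_def Q)
  show "euler_coeff Q l i = pairing (\<alpha> i) (\<alpha> l) - (if l = i then 1 else 0)"
    using assms(3,4) by (auto simp: euler_coeff_def pairing_simple Q)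
qed

text \<open>Reversal empties column i off the diagonal and moves its entries to row i, where they
  are again the Cartan integers at i.\<close>

lemma euler_coeff_reverse_at_sink:
  assumes "orientation D Q" and "sink Q i" and "i \<in> {1..n}" and "j \<in> {1..n}"
  shows "euler_coeff (reverse_at i Q) l j =
    (if j = i then (if l = i then 1 else 0)
     else euler_coeff Q l j + (if l = i then pairing (\<alpha> j) (\<alpha> i) else 0))"
proof -
  note Q = sink_arrows[OF assms(1,2)]
  show ?thesis
    using assms(3,4) by (auto simp: euler_coeff_def pairing_simple reverse_at_def Q insert_commute)
qed

text \<open>In weight coordinates, \<omega>_i - \<alpha>_i is the negated column i found in
  \<open>euler_coeff_sink\<close>. This is the case of the first letter of an adapted word.\<close>

lemma sink_weight:
  assumes "orientation D Q" and "sink Q i" and "i \<in> {1..n}" and "quiver_map n \<alpha> Q \<phi>"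
  shows "root_reflection (\<alpha> i) (\<omega> i) = - \<phi> (\<alpha> i)"
proof (rule pairing_eqI)
  fix l assume l: "l \<in> {1..n}"
  then show "pairing (root_reflection (\<alpha> i) (\<omega> i)) (\<alpha> l) = pairing (- \<phi> (\<alpha> i)) (\<alpha> l)"
    using assms(3,4)
    by (simp add: root_reflection_pairing pairing_diff pairing_scaleR pairing_minus pairing_weight
        quiver_map_def euler_coeff_sink(2)[OF assms(1,2,3) l])
qed

lemma quiver_map_reverse_at:
  assumes "orientation D Q" and "sink Q i" and i: "i \<in> {1..n}" and "quiver_map n \<alpha> Q \<phi>"
  shows "quiver_map n \<alpha> (reverse_at i Q) (root_reflection (\<alpha> i) \<circ> \<phi> \<circ> root_reflection (\<alpha> i))"
    (is "quiver_map n \<alpha> _ ?\<psi>")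
proof -
  have lin: "linear \<phi>"
    and \<phi>: "\<And>j l. j \<in> {1..n} \<Longrightarrow> l \<in> {1..n} \<Longrightarrow> pairing (\<phi> (\<alpha> j)) (\<alpha> l) = euler_coeff Q l j"
    using assms(4) by (auto simp: quiver_map_def)
  have "pairing (?\<psi> (\<alpha> j)) (\<alpha> l) = euler_coeff (reverse_at i Q) l j"
    if j: "j \<in> {1..n}" and l: "l \<in> {1..n}" for j l
  proof -
    let ?a = "\<lambda>j l. pairing (\<alpha> j) (\<alpha> l)"
    \<comment> \<open>The inner reflection acts on columns of the matrix, the outer one on
      rows.\<close>
    have "pairing (?\<psi> (\<alpha> j)) (\<alpha> l) = euler_coeff Q l j - ?a j i * euler_coeff Q l i -
        (euler_coeff Q i j - ?a j i * euler_coeff Q i i) * ?a i l"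
      by (simp add: root_reflection_pairing pairing_diff pairing_scaleR linear_diff[OF lin]
          linear_cmul[OF lin] \<phi>[OF j l] \<phi>[OF i l] \<phi>[OF j i] \<phi>[OF i i])
    \<comment> \<open>For j \<noteq> i the two products \<open>?a j i * ?a i l\<close> cancel and
      leave the new entry in row i. For j = i the Cartan integers cancel and leave the identity
      column.\<close>
    also have "\<dots> = euler_coeff (reverse_at i Q) l j"
      using euler_coeff_sink[OF assms(1,2) i l] euler_coeff_sink[OF assms(1,2) i j]
        euler_coeff_sink[OF assms(1,2) i i] pairing_simple[OF i i]
      unfolding euler_coeff_reverse_at_sink[OF assms(1,2) i j]
      by (cases "l = i"; cases "j = i") (simp_all add: algebra_simps)
    finally show ?thesis .
  qed
  moreover have "linear ?\<psi>"
    by (intro linear_compose lin linear_root_reflection)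
  ultimately show ?thesis
    by (simp add: quiver_map_def)
qed

text \<open>Q and \<phi> vary in the induction, because the tail of the word is adapted to
  \<open>reverse_at i Q\<close> and goes with the conjugated map.\<close>

lemma chamber_weight_adapted:
  assumes "set is \<subseteq> {1..n}" and "orientation D Q" and "quiver_map n \<alpha> Q \<phi>" and "adapted Q is"
    and "k \<in> {1..length is}"
  shows "chamber_weight \<alpha> \<omega> is k = - \<phi> (word_root \<alpha> is k)"
  using assms
proof (induction "is" arbitrary: Q \<phi> k)
  case (Cons i "is")
  let ?s = "root_reflection (\<alpha> i)"
  have i: "i \<in> {1..n}" and sink: "sink Q i"
    using Cons.prems by auto
  show ?case
  proof (cases "k = 1")
    case True
    then show ?thesis
      using sink_weight[OF Cons.prems(2) sink i Cons.prems(3)]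
      by (simp add: word_root_Cons_1 chamber_weight_def)
  next
    case False
    then obtain m where k: "k = Suc m" and m: "m \<in> {1..length is}"
      using Cons.prems(5) by (cases k) auto
    have "chamber_weight \<alpha> \<omega> is m = - (?s \<circ> \<phi> \<circ> ?s) (word_root \<alpha> is m)"
      using Cons.prems(1,4) m
      by (intro Cons.IH[OF _ orientation_reverse_at[OF Cons.prems(2)]
            quiver_map_reverse_at[OF Cons.prems(2) sink i Cons.prems(3)]]) auto
    \<comment> \<open>Applying s_i cancels the outer reflection of the conjugate; the inner one
      turns the m-th root of the tail into the k-th root of the whole word.\<close>
    then show ?thesis
      using m by (simp add: k word_root_Cons_Suc chamber_weight_Cons_Suc
          linear_neg[OF linear_root_reflection])
  qed
qed simp

end

theorem theorem2p4:
  fixes n :: nat and D :: "nat set set" and Q :: "(nat \<times> nat) set"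
    and \<Phi> :: "'a::euclidean_space set" and \<alpha> \<omega> :: "nat \<Rightarrow> 'a"
    and R :: "'a \<Rightarrow> 'a \<Rightarrow> real" and \<phi>\<^sub>R :: "'a \<Rightarrow> 'a"
    and w\<^sub>0 :: "'a \<Rightarrow> 'a" and "is" :: "nat list"
  assumes "ADE_diagram n D"
    and "root_system \<Phi>" and "simple_roots \<Phi> n \<alpha>" and "has_simply_laced_diagram n \<alpha> D"
    and "fundamental_weights n \<alpha> \<omega>"
    and "orientation D Q"
    and "ringel_form n \<alpha> Q R"
    and "ringel_map n \<alpha> \<omega> R \<phi>\<^sub>R"
    and "longest_element \<Phi> n \<alpha> w\<^sub>0"
    and "reduced_expression n \<alpha> w\<^sub>0 is"
    and "adapted Q is"
  shows "(\<exists>L. linear L \<and> (\<forall>\<beta>\<in>positive_roots \<Phi> n \<alpha>. chamber_map \<alpha> \<omega> is \<beta> = L \<beta>)) \<and>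
    (\<forall>k\<in>{1..card (positive_roots \<Phi> n \<alpha>)}.
       chamber_weight \<alpha> \<omega> is k = - \<phi>\<^sub>R (word_root \<alpha> is k))"
proof -
  interpret simple_root_system \<Phi> n \<alpha>
    by unfold_locales fact+
  interpret simply_laced n \<alpha> \<omega> D
    using assms(3,4,5) simple_root_in root_nonzero
    by unfold_locales (auto simp: simple_roots_def)
  have bij: "bij_betw (word_root \<alpha> is) {1..length is} pos"
    using bij_betw_word_root_longest assms(9,10) .
  \<comment> \<open>This identifies N with the length of the word, the range in which the weight
    formula is available.\<close>
  have card: "card pos = length is"
    using bij_betw_same_card[OF bij] by simp
  have "set is \<subseteq> {1..n}"
    using assms(10) by (simp add: reduced_expression_def)
  then have weight: "chamber_weight \<alpha> \<omega> is k = - \<phi>\<^sub>R (word_root \<alpha> is k)" if "k \<in> {1..length is}" for k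
    using chamber_weight_adapted ringel_map_quiver_map assms that by blast
  have "chamber_map \<alpha> \<omega> is \<beta> = - \<phi>\<^sub>R \<beta>" if \<beta>: "\<beta> \<in> pos" for \<beta>
  proof -
    obtain k where k: "k \<in> {1..length is}" "\<beta> = word_root \<alpha> is k"
      using \<beta> bij_betw_imp_surj_on[OF bij] by blast
    have "the_inv_into {1..length is} (word_root \<alpha> is) \<beta> = k"
      unfolding k(2) using bij_betw_imp_inj_on[OF bij] k(1) by (rule the_inv_into_f_f)
    then show ?thesis
      using weight k by (simp add: chamber_map_def)
  qed
  moreover have "linear (\<lambda>\<beta>. - \<phi>\<^sub>R \<beta>)"
    using assms(8) by (intro linear_compose_neg) (simp add: ringel_map_def)
  ultimately have "\<exists>L. linear L \<and> (\<forall>\<beta>\<in>pos. chamber_map \<alpha> \<omega> is \<beta> = L \<beta>)"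
    by (intro exI[of _ "\<lambda>\<beta>. - \<phi>\<^sub>R \<beta>"]) simp
  then show ?thesis
    unfolding card using weight by blast
qed

end
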